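(* Let $\widehat\nabla = d-\sum_{i\in I^\infty}\widehat H^\infty_i\,dt^\infty_i-\sum_{j\in I^0}\widehat H^0_j\,dt^0_j$ be the universal simply-laced quantum connection of a complete bipartite graph (with degenerate reading) and $\widehat\nabla'=d-\sum_{i\in I^\infty}\widehat H'^{\infty}_i\,dt^\infty_i-\sum_{j\in I^0}\widehat H'^{0}_j\,dt^0_j$ the connection encoding the images under the quantum comoment map $\widehat\mu^*$ of the FMTV Hamiltonians, both on the trivial bundle $\widehat A\times\mathbf{B}\to\mathbf{B}$. Then the $\widehat A$-valued one-form $\widehat\nabla-\widehat\nabla'$ on $\mathbf{B}$ vanishes in the semiclassical limit, i.e. at every point of $\mathbf{B}$ all its components along $\partial_{t^\infty_i}$ and $\partial_{t^0_j}$ lie in the kernel of $\sigma\colon\widehat A\to A_0$.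
   Context: Everything is over $\mathbb{C}$. Let $I=I^0\coprod I^\infty$ be a finite set with two nonempty parts; $V^\infty_i$ ($i\in I^\infty$) finite-dimensional vector spaces, $V^0_j$ ($j\in I^0$) one-dimensional vector spaces, $W^\infty=\bigoplus_iV^\infty_i$, $W^0=\bigoplus_jV^0_j$. Let $\mathbb{M}=\mathrm{Hom}(W^\infty,W^0)\oplus\mathrm{Hom}(W^0,W^\infty)$ with points $(Q,P)$, components $Q_{ji}\colon V^\infty_i\to V^0_j$, $P_{ij}\colon V^0_j\to V^\infty_i$, symplectic form $\mathrm{Tr}(dQ\wedge dP)$ (so the coordinates of $Q_{ji}$ and the transposed coordinates of $P_{ij}$ are conjugate, $\{(Q_{ji})_{rs},(P_{ij})_{sr}\}=1$, all other brackets of coordinates vanishing), and $A_0=\mathrm{Sym}(\mathbb{M}^* )$. $\mathbf{B}=(\mathbb{C}^{I^\infty}\setminus\{\text{diagonals}\})\times(\mathbb{C}^{I^0}\setminus\{\text{diagonals}\})$ with coordinates $t^\infty_i$, $t^0_j$. $A$ is the Weyl algebra, the quotient of the tensor algebra of $\mathbb{M}^*$ by the two-sided ideal generated by $f\otimes g-g\otimes f-\{f,g\}$ ($f,g\in\mathbb{M}^*$), filtered by $A_{\le k}$ induced from tensor degree; $\mathrm{gr}(A)\simeq A_0$, with symbol maps $\sigma_k\colon A_{\le k}\to(A_0)_k$. For $f\in A$ let $|f|=\min\{k:f\in A_{\le k}\}$; $\widehat A=\{\sum_kf_k\hslash^k: f_k\in A_{\le k},\ \lim_k(k-|f_k|)=+\infty\}\subseteq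 A[[\hslash]]$; the semiclassical limit is $\sigma(\sum_kf_k\hslash^k)=\sum_k\sigma_k(f_k)$. Hats on matrices denote matrices of the images in $A$ of the coordinate functions; traces of products are in the written order. The universal simply-laced quantum Hamiltonians are $$\widehat H^\infty_i=\sum_{k\in I^\infty\setminus\{i\},\,j\ne l\in I^0}\frac{\mathrm{Tr}(\widehat P_{il}\widehat Q_{lk}\widehat P_{kj}\widehat Q_{ji})}{t^\infty_i-t^\infty_k}\hslash^4+\sum_{k\in I^\infty\setminus\{i\},\,j\in I^0}\frac{\mathrm{Tr}(\widehat Q_{jk}\widehat P_{kj}\widehat Q_{ji}\widehat P_{ij})}{t^\infty_i-t^\infty_k}\hslash^4+\frac12\sum_{j\in I^0}t^0_j\bigl(\mathrm{Tr}(\widehat P_{ij}\widehat Q_{ji})+\mathrm{Tr}(\widehat Q_{ji}\widehat P_{ij})\bigr)\hslash^2,$$ $$\widehat H^0_j=\sum_{l\in I^0\setminus\{j\},\,i\ne k\in I^\infty}\frac{\mathrm{Tr}(\widehat Q_{ji}\widehat P_{il}\widehat Q_{lk}\widehat P_{kj})}{t^0_j-t^0_l}\hslash^4+\sum_{l\in I^0\setminus\{j\},\,i\in I^\infty}\frac{\mathrm{Tr}(\widehat P_{il}\widehat Q_{li}\widehat P_{ij}\widehat Q_{ji})}{t^0_j-t^0_l}\hslash^4+\frac12\sum_{i\in I^\infty}t^\infty_i\bigl(\mathrm{Tr}(\widehat Q_{ji}\widehat P_{ij})+\mathrm{Tr}(\widehat P_{ij}\widehat Q_{ji})\bigr)\hslash^2.$$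 The second set of Hamiltonians is the $\hslash$-deformation of the images, under $\widehat\mu^*\bigl((\widehat R_i)_{jk}\bigr)=\widehat Q_{ji}\widehat P_{ik}$, of the FMTV (Felder--Markov--Tarasov--Varchenko) Hamiltonians for $\mathfrak{gl}(W^0)$: $$\widehat H'^{\infty}_i=\sum_{k\in I^\infty\setminus\{i\},\,j,l\in I^0}\frac{\mathrm{Tr}(\widehat Q_{ji}\widehat P_{il}\widehat Q_{lk}\widehat P_{kj})}{t^\infty_i-t^\infty_k}\hslash^4+\sum_{j\in I^0}t^0_j\mathrm{Tr}(\widehat Q_{ji}\widehat P_{ij})\hslash^2,$$ $$\widehat H'^{0}_j=\sum_{k\in I^0\setminus\{j\},\,i,l\in I^\infty}\frac{\mathrm{Tr}(\widehat Q_{ji}\widehat P_{ik}\widehat Q_{kl}\widehat P_{lj})}{t^0_j-t^0_k}\hslash^4+\sum_{i\in I^\infty}t^\infty_i\mathrm{Tr}(\widehat Q_{ji}\widehat P_{ij})\hslash^2.$$ *)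

theory Defs
  imports Complex_Main "HOL-Library.Poly_Mapping" "HOL-Algebra.QuotRing"
begin

section \<open>The tensor algebra on a set of coordinates\<close>

text \<open>
  The library only provides the convolution product on \<^typ>\<open>'b \<Rightarrow>\<^sub>0 complex\<close> for
  additively written monoids \<^typ>\<open>'b\<close>, so words under concatenation are wrapped in a type
  whose (noncommutative) addition is concatenation. Then \<open>'x word \<Rightarrow>\<^sub>0 complex\<close> is the tensor
  algebra of the vector space with basis \<^typ>\<open>'x\<close>: the word with letters \<open>x1, \<dots>, xk\<close> is the
  basis tensor \<open>x1 \<otimes> \<cdots> \<otimes> xk\<close>.
\<close>

datatype 'x word = Word (letters: "'x list")

instantiation word :: (type) monoid_add
begin

definition zero_word_def: "0 = Word []"

definition plus_word_def: "u + v = Word (letters u @ letters v)"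

instance
  by standard (simp_all add: zero_word_def plus_word_def)

end

abbreviation tensor_degree :: "'x word \<Rightarrow> nat"
  where "tensor_degree w \<equiv> length (letters w)"

abbreviation scalar_tensor :: "complex \<Rightarrow> 'x word \<Rightarrow>\<^sub>0 complex"
  where "scalar_tensor c \<equiv> Poly_Mapping.single 0 c"

abbreviation letter_tensor :: "'x \<Rightarrow> 'x word \<Rightarrow>\<^sub>0 complex"
  where "letter_tensor x \<equiv> Poly_Mapping.single (Word [x]) 1"

text \<open>
  The symmetric algebra is the algebra of commutative polynomials
  \<open>('x \<Rightarrow>\<^sub>0 nat) \<Rightarrow>\<^sub>0 complex\<close>. The following is the image in it of the component of
  tensor degree \<open>k\<close> of \<open>x\<close>: the word with letters \<open>x1, \<dots>, xk\<close> goes to the monomial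
  \<open>x1 \<cdots> xk\<close>.
\<close>

definition word_monomial :: "'x word \<Rightarrow> ('x \<Rightarrow>\<^sub>0 nat)"
  where "word_monomial w = (\<Sum>x\<leftarrow>letters w. Poly_Mapping.single x 1)"

definition sym_component ::
    "nat \<Rightarrow> ('x word \<Rightarrow>\<^sub>0 complex) \<Rightarrow> (('x \<Rightarrow>\<^sub>0 nat) \<Rightarrow>\<^sub>0 complex)"
  where "sym_component k x =
    (\<Sum>w \<in> {w \<in> Poly_Mapping.keys x. tensor_degree w = k}.
       Poly_Mapping.single (word_monomial w) (Poly_Mapping.lookup x w))"


section \<open>Matrices with entries in a ring given by a record\<close>

datatype 'a matrix = Matrix (nrows: nat) (ncols: nat) (entry: "nat \<Rightarrow> nat \<Rightarrow> 'a")

definition matrix_mult :: "('a, 'b) ring_scheme \<Rightarrow> 'a matrix \<Rightarrow> 'a matrix \<Rightarrow> 'a matrix"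
    (infixl \<open>\<bullet>\<index>\<close> 70)
  where "X \<bullet>\<^bsub>R\<^esub> Y = Matrix (nrows X) (ncols Y)
    (\<lambda>r s. \<Oplus>\<^bsub>R\<^esub>n\<in>{..<ncols X}. entry X r n \<otimes>\<^bsub>R\<^esub> entry Y n s)"

definition matrix_trace :: "('a, 'b) ring_scheme \<Rightarrow> 'a matrix \<Rightarrow> 'a" (\<open>Tr\<index>\<close>)
  where "Tr\<^bsub>R\<^esub> X = (\<Oplus>\<^bsub>R\<^esub>r\<in>{..<nrows X}. entry X r r)"


section \<open>The Weyl algebra and the simply-laced quantum Hamiltonians\<close>

text \<open>
  Bases of the spaces \<open>V\<^sub>v\<close> of dimension \<open>d v\<close> (for \<open>v\<close> in \<open>I = I0 \<union> Iinf\<close>) are chosen once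
  and for all. \<open>Q_coord j r i s\<close> is the coordinate \<open>(Q\<^sub>j\<^sub>i)\<^sub>r\<^sub>s\<close> and \<open>P_coord i s j r\<close> is the
  coordinate \<open>(P\<^sub>i\<^sub>j)\<^sub>s\<^sub>r\<close>, where \<open>i\<close> is in \<open>Iinf\<close> and \<open>j\<close> in \<open>I0\<close>; matrix indices
  start at 0.
\<close>

datatype 'v coord = Q_coord 'v nat 'v nat | P_coord 'v nat 'v nat

type_synonym 'v tensor = "'v coord word \<Rightarrow>\<^sub>0 complex"

fun coord_bracket :: "'v coord \<Rightarrow> 'v coord \<Rightarrow> complex"
  where
    "coord_bracket (Q_coord j r i s) (P_coord i' s' j' r') =
      (if j = j' \<and> r = r' \<and> i = i' \<and> s = s' then 1 else 0)"
  | "coord_bracket (P_coord i' s' j' r') (Q_coord j r i s) =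
      (if j = j' \<and> r = r' \<and> i = i' \<and> s = s' then -1 else 0)"
  | "coord_bracket (Q_coord _ _ _ _) (Q_coord _ _ _ _) = 0"
  | "coord_bracket (P_coord _ _ _ _) (P_coord _ _ _ _) = 0"

text \<open>Bilinear extension of the bracket to elements of tensor degree 1.\<close>

definition linear_bracket :: "'v tensor \<Rightarrow> 'v tensor \<Rightarrow> complex"
  where "linear_bracket f g =
    (\<Sum>u\<in>Poly_Mapping.keys f. \<Sum>v\<in>Poly_Mapping.keys g.
       Poly_Mapping.lookup f u * Poly_Mapping.lookup g v
         * coord_bracket (hd (letters u)) (hd (letters v)))"

text \<open>\<open>\<complex>\<^sup>S\<close> without the diagonals.\<close>

definition configurations :: "'v set \<Rightarrow> ('v \<Rightarrow> complex) set"
  where "configurations S = {t \<in> S \<rightarrow>\<^sub>E UNIV. inj_on t S}"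

text \<open>
  A point of the base \<open>B\<close> is a pair of tuples, consisting of the times at infinity and the
  times at zero. A one-form on it is given at each point by its components along the
  \<open>\<partial>/\<partial>t\<^sub>v\<close>, \<open>v\<close> in \<open>I\<close>; a connection \<open>d + \<omega>\<close> on the trivial bundle is given by \<open>\<omega>\<close>.
\<close>

type_synonym 'v point = "('v \<Rightarrow> complex) \<times> ('v \<Rightarrow> complex)"

type_synonym ('v, 'a) one_form = "'v point \<Rightarrow> 'v \<Rightarrow> 'a"

locale simply_laced =
  fixes I0 Iinf :: "'v set"
    and d :: "'v \<Rightarrow> nat"
begin

definition coords :: "'v coord set"
  where "coords =
    {Q_coord j r i s | j r i s. j \<in> I0 \<and> i \<in> Iinf \<and> r < d j \<and> s < d i} \<union>
    {P_coord i s j r | i s j r. j \<in> I0 \<and> i \<in> Iinf \<and> r < d j \<and> s < d i}"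

definition tensor_algebra :: "'v tensor ring"
  where "tensor_algebra =
    \<lparr>carrier = {x. \<forall>w\<in>Poly_Mapping.keys x. set (letters w) \<subseteq> coords},
     mult = (*), one = 1, zero = 0, add = (+)\<rparr>"

definition linear_functions :: "'v tensor set"
  where "linear_functions =
    {f \<in> carrier tensor_algebra. \<forall>w\<in>Poly_Mapping.keys f. tensor_degree w = 1}"

definition weyl_relations :: "'v tensor set"
  where "weyl_relations =
    {f * g - g * f - scalar_tensor (linear_bracket f g) | f g.
       f \<in> linear_functions \<and> g \<in> linear_functions}"

definition weyl_ideal :: "'v tensor set"
  where "weyl_ideal = Idl\<^bsub>tensor_algebra\<^esub> weyl_relations"

definition weyl :: "'v tensor set ring"
  where "weyl = tensor_algebra Quot weyl_ideal"

definition to_weyl :: "'v tensor \<Rightarrow> 'v tensor set"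
  where "to_weyl x = weyl_ideal +>\<^bsub>tensor_algebra\<^esub> x"

definition weyl_scale :: "complex \<Rightarrow> 'v tensor set \<Rightarrow> 'v tensor set" (infixr \<open>*\<^sub>W\<close> 75)
  where "c *\<^sub>W a = to_weyl (scalar_tensor c) \<otimes>\<^bsub>weyl\<^esub> a"

definition tensors_upto :: "nat \<Rightarrow> 'v tensor set"
  where "tensors_upto k =
    {x \<in> carrier tensor_algebra. \<forall>w\<in>Poly_Mapping.keys x. tensor_degree w \<le> k}"

definition weyl_upto :: "nat \<Rightarrow> 'v tensor set set"
  where "weyl_upto k = to_weyl ` tensors_upto k"

text \<open>
  \<open>weyl_symbol k\<close> is the map \<open>\<sigma>\<^sub>k\<close> from \<open>weyl_upto k\<close> to its quotient by the preceding filtration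
  step, followed by the isomorphism of the associated graded algebra with the symmetric algebra
  which is the identity on generators: the class of a tensor of degree at most \<open>k\<close> is sent to the
  image of the degree \<open>k\<close> part of that tensor. That this does not depend on the chosen tensor is the
  Poincare-Birkhoff-Witt property of the Weyl algebra.
\<close>

definition weyl_symbol :: "nat \<Rightarrow> 'v tensor set \<Rightarrow> (('v coord \<Rightarrow>\<^sub>0 nat) \<Rightarrow>\<^sub>0 complex)"
  where "weyl_symbol k a = (THE s. \<exists>x\<in>tensors_upto k. to_weyl x = a \<and> s = sym_component k x)"

definition weyl_order :: "'v tensor set \<Rightarrow> nat"
  where "weyl_order a = (LEAST k. a \<in> weyl_upto k)"

text \<open>A formal power series in \<open>\<hbar>\<close> over the Weyl algebra is the sequence of its coefficients.\<close>

definition weyl_hat :: "(nat \<Rightarrow> 'v tensor set) set"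
  where "weyl_hat =
    {f. (\<forall>k. f k \<in> weyl_upto k) \<and>
        filterlim (\<lambda>k. int k - int (weyl_order (f k))) at_top sequentially}"

text \<open>On \<^term>\<open>weyl_hat\<close> only finitely many of the summands are nonzero.\<close>

definition semiclassical_limit ::
    "(nat \<Rightarrow> 'v tensor set) \<Rightarrow> (('v coord \<Rightarrow>\<^sub>0 nat) \<Rightarrow>\<^sub>0 complex)"
  where "semiclassical_limit f =
    (\<Sum>k \<in> {k. weyl_symbol k (f k) \<noteq> 0}. weyl_symbol k (f k))"

definition semiclassical_kernel :: "(nat \<Rightarrow> 'v tensor set) set"
  where "semiclassical_kernel = {f \<in> weyl_hat. semiclassical_limit f = 0}"

definition hbar_monom :: "'v tensor set \<Rightarrow> nat \<Rightarrow> (nat \<Rightarrow> 'v tensor set)" (infix \<open>\<hbar>^\<close> 70)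
  where "a \<hbar>^ k = (\<lambda>n. if n = k then a else \<zero>\<^bsub>weyl\<^esub>)"

definition series_add ::
    "(nat \<Rightarrow> 'v tensor set) \<Rightarrow> (nat \<Rightarrow> 'v tensor set) \<Rightarrow> (nat \<Rightarrow> 'v tensor set)" (infixl \<open>\<oplus>\<^sub>\<hbar>\<close> 65)
  where "f \<oplus>\<^sub>\<hbar> g = (\<lambda>n. f n \<oplus>\<^bsub>weyl\<^esub> g n)"

definition series_uminus :: "(nat \<Rightarrow> 'v tensor set) \<Rightarrow> (nat \<Rightarrow> 'v tensor set)"
  where "series_uminus f = (\<lambda>n. \<ominus>\<^bsub>weyl\<^esub> f n)"

definition series_minus ::
    "(nat \<Rightarrow> 'v tensor set) \<Rightarrow> (nat \<Rightarrow> 'v tensor set) \<Rightarrow> (nat \<Rightarrow> 'v tensor set)"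
  where "series_minus f g = (\<lambda>n. f n \<ominus>\<^bsub>weyl\<^esub> g n)"

definition Qh :: "'v \<Rightarrow> 'v \<Rightarrow> 'v tensor set matrix"
  where "Qh j i = Matrix (d j) (d i) (\<lambda>r s. to_weyl (letter_tensor (Q_coord j r i s)))"

definition Ph :: "'v \<Rightarrow> 'v \<Rightarrow> 'v tensor set matrix"
  where "Ph i j = Matrix (d i) (d j) (\<lambda>s r. to_weyl (letter_tensor (P_coord i s j r)))"

definition H_inf :: "'v point \<Rightarrow> 'v \<Rightarrow> (nat \<Rightarrow> 'v tensor set)"
  where "H_inf = (\<lambda>(tinf, t0) i.
    (\<Oplus>\<^bsub>weyl\<^esub>k\<in>Iinf - {i}. \<Oplus>\<^bsub>weyl\<^esub>j\<in>I0. \<Oplus>\<^bsub>weyl\<^esub>l\<in>I0 - {j}.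
        (1 / (tinf i - tinf k)) *\<^sub>W
          Tr\<^bsub>weyl\<^esub> (Ph i l \<bullet>\<^bsub>weyl\<^esub> Qh l k \<bullet>\<^bsub>weyl\<^esub> Ph k j \<bullet>\<^bsub>weyl\<^esub> Qh j i)) \<hbar>^ 4
    \<oplus>\<^sub>\<hbar>
    (\<Oplus>\<^bsub>weyl\<^esub>k\<in>Iinf - {i}. \<Oplus>\<^bsub>weyl\<^esub>j\<in>I0.
        (1 / (tinf i - tinf k)) *\<^sub>W
          Tr\<^bsub>weyl\<^esub> (Qh j k \<bullet>\<^bsub>weyl\<^esub> Ph k j \<bullet>\<^bsub>weyl\<^esub> Qh j i \<bullet>\<^bsub>weyl\<^esub> Ph i j)) \<hbar>^ 4
    \<oplus>\<^sub>\<hbar>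
    ((1 / 2) *\<^sub>W (\<Oplus>\<^bsub>weyl\<^esub>j \<in> I0. t0 j *\<^sub>W
        (Tr\<^bsub>weyl\<^esub> (Ph i j \<bullet>\<^bsub>weyl\<^esub> Qh j i) \<oplus>\<^bsub>weyl\<^esub> Tr\<^bsub>weyl\<^esub> (Qh j i \<bullet>\<^bsub>weyl\<^esub> Ph i j)))) \<hbar>^ 2)"

definition H_zero :: "'v point \<Rightarrow> 'v \<Rightarrow> (nat \<Rightarrow> 'v tensor set)"
  where "H_zero = (\<lambda>(tinf, t0) j.
    (\<Oplus>\<^bsub>weyl\<^esub>l\<in>I0 - {j}. \<Oplus>\<^bsub>weyl\<^esub>i\<in>Iinf. \<Oplus>\<^bsub>weyl\<^esub>k\<in>Iinf - {i}.
        (1 / (t0 j - t0 l)) *\<^sub>W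
          Tr\<^bsub>weyl\<^esub> (Qh j i \<bullet>\<^bsub>weyl\<^esub> Ph i l \<bullet>\<^bsub>weyl\<^esub> Qh l k \<bullet>\<^bsub>weyl\<^esub> Ph k j)) \<hbar>^ 4
    \<oplus>\<^sub>\<hbar>
    (\<Oplus>\<^bsub>weyl\<^esub>l\<in>I0 - {j}. \<Oplus>\<^bsub>weyl\<^esub>i\<in>Iinf.
        (1 / (t0 j - t0 l)) *\<^sub>W
          Tr\<^bsub>weyl\<^esub> (Ph i l \<bullet>\<^bsub>weyl\<^esub> Qh l i \<bullet>\<^bsub>weyl\<^esub> Ph i j \<bullet>\<^bsub>weyl\<^esub> Qh j i)) \<hbar>^ 4
    \<oplus>\<^sub>\<hbar>
    ((1 / 2) *\<^sub>W (\<Oplus>\<^bsub>weyl\<^esub>i \<in> Iinf. tinf i *\<^sub>W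
        (Tr\<^bsub>weyl\<^esub> (Qh j i \<bullet>\<^bsub>weyl\<^esub> Ph i j) \<oplus>\<^bsub>weyl\<^esub> Tr\<^bsub>weyl\<^esub> (Ph i j \<bullet>\<^bsub>weyl\<^esub> Qh j i)))) \<hbar>^ 2)"

text \<open>
  Images of the Felder-Markov-Tarasov-Varchenko Hamiltonians under the quantum comoment map,
  which sends the generator \<open>(R\<^sub>i)\<^sub>j\<^sub>k\<close> to \<open>Q\<^sub>j\<^sub>i P\<^sub>i\<^sub>k\<close>.
\<close>

definition FMTV_inf :: "'v point \<Rightarrow> 'v \<Rightarrow> (nat \<Rightarrow> 'v tensor set)"
  where "FMTV_inf = (\<lambda>(tinf, t0) i.
    (\<Oplus>\<^bsub>weyl\<^esub>k\<in>Iinf - {i}. \<Oplus>\<^bsub>weyl\<^esub>j\<in>I0. \<Oplus>\<^bsub>weyl\<^esub>l\<in>I0.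
        (1 / (tinf i - tinf k)) *\<^sub>W
          Tr\<^bsub>weyl\<^esub> (Qh j i \<bullet>\<^bsub>weyl\<^esub> Ph i l \<bullet>\<^bsub>weyl\<^esub> Qh l k \<bullet>\<^bsub>weyl\<^esub> Ph k j)) \<hbar>^ 4
    \<oplus>\<^sub>\<hbar>
    (\<Oplus>\<^bsub>weyl\<^esub>j \<in> I0. t0 j *\<^sub>W Tr\<^bsub>weyl\<^esub> (Qh j i \<bullet>\<^bsub>weyl\<^esub> Ph i j)) \<hbar>^ 2)"

definition FMTV_zero :: "'v point \<Rightarrow> 'v \<Rightarrow> (nat \<Rightarrow> 'v tensor set)"
  where "FMTV_zero = (\<lambda>(tinf, t0) j.
    (\<Oplus>\<^bsub>weyl\<^esub>k\<in>I0 - {j}. \<Oplus>\<^bsub>weyl\<^esub>i\<in>Iinf. \<Oplus>\<^bsub>weyl\<^esub>l\<in>Iinf.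
        (1 / (t0 j - t0 k)) *\<^sub>W
          Tr\<^bsub>weyl\<^esub> (Qh j i \<bullet>\<^bsub>weyl\<^esub> Ph i k \<bullet>\<^bsub>weyl\<^esub> Qh k l \<bullet>\<^bsub>weyl\<^esub> Ph l j)) \<hbar>^ 4
    \<oplus>\<^sub>\<hbar>
    (\<Oplus>\<^bsub>weyl\<^esub>i \<in> Iinf. tinf i *\<^sub>W Tr\<^bsub>weyl\<^esub> (Qh j i \<bullet>\<^bsub>weyl\<^esub> Ph i j)) \<hbar>^ 2)"

definition base :: "'v point set"
  where "base = configurations Iinf \<times> configurations I0"

text \<open>
  The connections \<open>d - \<Sum> H\<^sub>v dt\<^sub>v\<close>, given by their connection forms as explained above.
\<close>

definition simply_laced_connection :: "('v, nat \<Rightarrow> 'v tensor set) one_form"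
  where "simply_laced_connection p v =
    series_uminus (if v \<in> Iinf then H_inf p v else H_zero p v)"

definition FMTV_connection :: "('v, nat \<Rightarrow> 'v tensor set) one_form"
  where "FMTV_connection p v =
    series_uminus (if v \<in> Iinf then FMTV_inf p v else FMTV_zero p v)"

definition connection_difference ::
    "('v, nat \<Rightarrow> 'v tensor set) one_form \<Rightarrow> ('v, nat \<Rightarrow> 'v tensor set) one_form \<Rightarrow>
     ('v, nat \<Rightarrow> 'v tensor set) one_form"
  where "connection_difference \<omega> \<omega>' p v = series_minus (\<omega> p v) (\<omega>' p v)"

end

end

theory Submission
  imports Defs
begin

text \<open>
  The two families of Hamiltonians differ only in the order of the factors inside traces of products.
  Symbols are multiplicative and take values in a commutative ring, and over a commutative ring
  traces are cyclic. Hence the symbol of each trace depends only on the cycle of the graph along which the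
  product is taken, not on its starting point (\<open>has_symbol_four_cycle_Q\<close>,
  \<open>has_symbol_four_cycle_P\<close>, \<open>four_cycle_rotate\<close>, and similarly for cycles of length two). The
  simply-laced Hamiltonians treat the degenerate four-cycles, which visit one node twice, in a
  separate sum; added to the sum over the other cycles it gives the sum of the FMTV
  Hamiltonian. So corresponding coefficients of the power series have the same symbols.

  This argument needs the symbol maps to be well defined: a tensor of degree at most \<open>k\<close> in the ideal
  of relations must have zero component of degree \<open>k\<close> in the symmetric algebra. This is the
  Poincare-Birkhoff-Witt property of the Weyl algebra, and it is proved with a representation on
  polynomials: the coordinates \<open>Q\<close> act by multiplication, the coordinates \<open>P\<close> by
  multiplication minus the derivative with respect to the conjugate \<open>Q\<close>. These operators satisfy the
  relations (\<open>coord_action_commutator\<close>), so the ideal acts as zero. On the other hand a product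
  of \<open>k\<close> such operators, applied to \<open>1\<close>, is the product of the \<open>k\<close> coordinates up to terms of
  lower degree (\<open>foldr_coord_action_leading_term\<close>), so the component of degree \<open>k\<close> of a tensor can be
  read off from its action.
\<close>

section \<open>Linear extension of a function on a basis\<close>

abbreviation scalar :: "complex \<Rightarrow> 'm::comm_monoid_add \<Rightarrow>\<^sub>0 complex"
  where "scalar c \<equiv> Poly_Mapping.single 0 c"

lemma scalar_sum: "scalar (\<Sum>a\<in>A. f a) = (\<Sum>a\<in>A. scalar (f a))"
  by (induction A rule: infinite_finite_induct) (simp_all add: single_add)

text \<open>
  Tensors and polynomials are both finitely supported functions on a basis. Partial
  derivatives, the dependence of the action of a tensor on that tensor, and the components in the symmetric
  algebra are all extensions of their values on basis elements, so additivity is proved here once for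
  all of them.
\<close>

definition linear_extension ::
    "('b \<Rightarrow> 'm::comm_monoid_add \<Rightarrow>\<^sub>0 complex) \<Rightarrow> ('b \<Rightarrow>\<^sub>0 complex) \<Rightarrow> ('m \<Rightarrow>\<^sub>0 complex)"
  where "linear_extension g x =
    (\<Sum>w\<in>Poly_Mapping.keys x. scalar (Poly_Mapping.lookup x w) * g w)"

lemma linear_extension_superset:
  assumes "finite A" and "Poly_Mapping.keys x \<subseteq> A"
  shows "linear_extension g x = (\<Sum>w\<in>A. scalar (Poly_Mapping.lookup x w) * g w)"
  unfolding linear_extension_def using assms
  by (intro sum.mono_neutral_left) (auto simp: in_keys_iff)

lemma linear_extension_add:
  "linear_extension g (x + y) = linear_extension g x + linear_extension g y"
proof -
  let ?A = "Poly_Mapping.keys x \<union> Poly_Mapping.keys y"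
  have "Poly_Mapping.keys (x + y) \<subseteq> ?A" by (rule Poly_Mapping.keys_add)
  then show ?thesis
    by (simp add: linear_extension_superset[of ?A] lookup_add single_add
        distrib_right sum.distrib)
qed

lemma linear_extension_zero [simp]: "linear_extension g 0 = 0"
  by (simp add: linear_extension_def)

lemma linear_extension_uminus: "linear_extension g (- x) = - linear_extension g x"
  using linear_extension_add[of g x "- x"] by (simp add: eq_neg_iff_add_eq_0 add.commute)

lemma linear_extension_diff:
  "linear_extension g (x - y) = linear_extension g x - linear_extension g y"
  using linear_extension_add[of g x "- y"] by (simp add: linear_extension_uminus)

lemma linear_extension_sum:
  "linear_extension g (\<Sum>a\<in>A. f a) = (\<Sum>a\<in>A. linear_extension g (f a))"
  by (induction A rule: infinite_finite_induct) (simp_all add: linear_extension_add)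

lemma linear_extension_single [simp]:
  "linear_extension g (Poly_Mapping.single w c) = scalar c * g w"
  by (simp add: linear_extension_def)

lemma poly_mapping_eq_sum_single:
  "x = (\<Sum>w\<in>Poly_Mapping.keys x. Poly_Mapping.single w (Poly_Mapping.lookup x w))"
proof (rule poly_mapping_eqI)
  fix k
  have "(\<Sum>w\<in>Poly_Mapping.keys x. Poly_Mapping.lookup (Poly_Mapping.single w (Poly_Mapping.lookup x w)) k)
      = (\<Sum>w\<in>Poly_Mapping.keys x. if w = k then Poly_Mapping.lookup x w else 0)"
    by (intro sum.cong) (auto simp: lookup_single when_def)
  then show "Poly_Mapping.lookup x k = Poly_Mapping.lookup
      (\<Sum>w\<in>Poly_Mapping.keys x. Poly_Mapping.single w (Poly_Mapping.lookup x w)) k"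
    by (simp add: lookup_sum in_keys_iff)
qed

lemma linear_extension_mult:
  fixes x y :: "'b::monoid_add \<Rightarrow>\<^sub>0 complex"
  shows "linear_extension g (x * y) =
    (\<Sum>u\<in>Poly_Mapping.keys x. \<Sum>v\<in>Poly_Mapping.keys y.
       scalar (Poly_Mapping.lookup x u * Poly_Mapping.lookup y v) * g (u + v))"
proof -
  have "x * y = (\<Sum>u\<in>Poly_Mapping.keys x. \<Sum>v\<in>Poly_Mapping.keys y.
      Poly_Mapping.single (u + v) (Poly_Mapping.lookup x u * Poly_Mapping.lookup y v))"
    by (subst poly_mapping_eq_sum_single[of x], subst poly_mapping_eq_sum_single[of y])
      (simp add: sum_product mult_single)
  then show ?thesis by (simp add: linear_extension_sum)
qed

lemma scalar_mult_linear_extension: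
  "linear_extension g (scalar c * x) = scalar c * linear_extension g x"
proof -
  have "linear_extension g (scalar c * x) = (\<Sum>v\<in>Poly_Mapping.keys x. 
      linear_extension g (scalar c * Poly_Mapping.single v (Poly_Mapping.lookup x v)))"
    by (subst poly_mapping_eq_sum_single[of x]) (simp add: sum_distrib_left linear_extension_sum)
  also have "\<dots> = (\<Sum>v\<in>Poly_Mapping.keys x. scalar c * (scalar (Poly_Mapping.lookup x v) * g v))"
    by (simp add: mult_single mult.assoc[symmetric])
  also have "\<dots> = scalar c * linear_extension g x"
    by (simp only: sum_distrib_left linear_extension_def)
  finally show ?thesis .
qed

lemma poly_mapping_linear_induct [case_names single add]:
  fixes x :: "'b \<Rightarrow>\<^sub>0 complex"
  assumes "\<And>w c. P (Poly_Mapping.single w c)" and "\<And>x y. P x \<Longrightarrow> P y \<Longrightarrow> P (x + y)"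
  shows "P x"
proof -
  have "P (\<Sum>w\<in>A. Poly_Mapping.single w (Poly_Mapping.lookup x w))" if "finite A" for A
    using that by induction (use assms(1)[of _ 0] assms in auto)
  from this[OF finite_keys[of x]] show ?thesis by (simp only: poly_mapping_eq_sum_single[symmetric])
qed

section \<open>Partial derivatives of polynomials\<close>

type_synonym 'x polynomial = "('x \<Rightarrow>\<^sub>0 nat) \<Rightarrow>\<^sub>0 complex"

definition variable :: "'x \<Rightarrow> 'x polynomial"
  where "variable x = Poly_Mapping.single (Poly_Mapping.single x 1) 1"

definition partial_derivative :: "'x \<Rightarrow> 'x polynomial \<Rightarrow> 'x polynomial"
  where "partial_derivative x = linear_extension
    (\<lambda>m. Poly_Mapping.single (m - Poly_Mapping.single x 1) (of_nat (Poly_Mapping.lookup m x)))"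

lemma partial_derivative_add:
  "partial_derivative x (p + q) = partial_derivative x p + partial_derivative x q"
  by (simp add: partial_derivative_def linear_extension_add)

lemma partial_derivative_diff:
  "partial_derivative x (p - q) = partial_derivative x p - partial_derivative x q"
  by (simp add: partial_derivative_def linear_extension_diff)

lemma partial_derivative_scalar:
  "partial_derivative x (scalar c * p) = scalar c * partial_derivative x p"
  by (simp add: partial_derivative_def scalar_mult_linear_extension)

lemma partial_derivative_single:
  "partial_derivative x (Poly_Mapping.single m c) =
    Poly_Mapping.single (m - Poly_Mapping.single x 1) (c * of_nat (Poly_Mapping.lookup m x))"
  by (simp add: partial_derivative_def mult_single)

lemma partial_derivative_variable_mult:
  "partial_derivative x (variable y * p) =
    variable y * partial_derivative x p + (if x = y then p else 0)"
proof (induction p rule: poly_mapping_linear_induct)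
  case (single m c)
  show ?case
  proof (cases "x = y")
    case True
    have "Poly_Mapping.single y 1 + (m - Poly_Mapping.single y 1) = m"
      if "Poly_Mapping.lookup m y \<noteq> 0"
      using that
      by (intro poly_mapping_eqI) (auto simp: lookup_add lookup_minus lookup_single when_def)
    then show ?thesis using True
      by (cases "Poly_Mapping.lookup m y = 0")
        (simp_all add: variable_def partial_derivative_single mult_single lookup_add algebra_simps
          flip: single_add)
  next
    case False
    then have "Poly_Mapping.single y 1 + m - Poly_Mapping.single x 1
        = Poly_Mapping.single y 1 + (m - Poly_Mapping.single x 1)"
      by (intro poly_mapping_eqI) (auto simp: lookup_add lookup_minus lookup_single when_def)
    then show ?thesis using False
      by (simp add: variable_def partial_derivative_single mult_single lookup_add lookup_single when_def)
  qed
next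
  case (add p q)
  then show ?case by (simp add: partial_derivative_add distrib_left)
qed

lemma partial_derivative_commute:
  "partial_derivative x (partial_derivative y p) = partial_derivative y (partial_derivative x p)"
proof (induction p rule: poly_mapping_linear_induct)
  case (single m c)
  have "m - Poly_Mapping.single x 1 - Poly_Mapping.single y 1
      = m - Poly_Mapping.single y 1 - Poly_Mapping.single x (1 :: nat)" for x y
    by (intro poly_mapping_eqI) (auto simp: lookup_minus)
  from this[of x y] show ?case
    by (cases "x = y") (simp_all add: partial_derivative_single lookup_minus lookup_single when_def mult_ac)
qed (simp add: partial_derivative_add)

section \<open>The tensor algebra acting on polynomials by differential operators\<close>

text \<open>
  The operators that represent the coordinates. The usual quantization makes the derivative
  alone the partner of a multiplication operator; adding the multiplication by the \<open>P\<close> coordinate does not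
  change the commutators, and makes every coordinate raise the degree with leading
  term multiplication by that coordinate.
\<close>

fun coord_action :: "'v coord \<Rightarrow> 'v coord polynomial \<Rightarrow> 'v coord polynomial"
  where
    "coord_action (Q_coord j r i s) p = variable (Q_coord j r i s) * p"
  | "coord_action (P_coord i s j r) p =
      variable (P_coord i s j r) * p - partial_derivative (Q_coord j r i s) p"

lemma coord_action_add:
  "coord_action x (p + q) = coord_action x p + coord_action x q"
  by (cases x) (simp_all add: partial_derivative_add algebra_simps)

lemma coord_action_scalar:
  "coord_action x (scalar c * p) = scalar c * coord_action x p"
  by (cases x) (simp_all add: partial_derivative_scalar right_diff_distrib mult.left_commute)

lemma coord_action_commutator:
  "coord_action x (coord_action y p) - coord_action y (coord_action x p)
    = scalar (coord_bracket x y) * p"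
  by (cases x; cases y)
    (auto simp: partial_derivative_diff partial_derivative_variable_mult right_diff_distrib
      distrib_left mult.left_commute single_uminus intro: partial_derivative_commute)

definition word_action :: "'v coord word \<Rightarrow> 'v coord polynomial \<Rightarrow> 'v coord polynomial"
  where "word_action w = foldr coord_action (letters w)"

definition tensor_action :: "'v tensor \<Rightarrow> 'v coord polynomial \<Rightarrow> 'v coord polynomial"
  where "tensor_action x p = linear_extension (\<lambda>w. word_action w p) x"

lemma word_action_plus: "word_action (u + v) p = word_action u (word_action v p)"
  by (simp add: word_action_def plus_word_def)

text \<open>
  Words act by linear operators, which lets the action of one tensor be pulled into
  the sum that defines the action of another.
\<close>

lemma foldr_coord_action_linear_extension:
  "foldr coord_action xs (linear_extension g x) = linear_extension (\<lambda>w. foldr coord_action xs (g w)) x"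
proof (induction x rule: poly_mapping_linear_induct)
  case (single w c)
  show ?case by (induction xs) (simp_all add: coord_action_scalar)
next
  case (add x y)
  have "foldr coord_action xs (p + q) = foldr coord_action xs p + foldr coord_action xs q" for p q
    by (induction xs) (simp_all add: coord_action_add)
  with add show ?case by (simp add: linear_extension_add)
qed

lemma tensor_action_mult:
  "tensor_action (x * y) p = tensor_action x (tensor_action y p)"
proof -
  have "tensor_action x (tensor_action y p)
      = linear_extension (\<lambda>u. linear_extension (\<lambda>v. word_action u (word_action v p)) y) x"
    by (simp add: tensor_action_def word_action_def foldr_coord_action_linear_extension)
  also have "\<dots> = tensor_action (x * y) p"
    unfolding tensor_action_def linear_extension_mult word_action_plus
    by (simp add: linear_extension_def sum_distrib_left mult_single mult.assoc[symmetric])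
  finally show ?thesis ..
qed

lemma tensor_action_zero [simp]: "tensor_action (x :: 'v tensor) 0 = 0"
proof -
  have "coord_action y 0 = 0" for y :: "'v coord"
    using coord_action_scalar[of y 0 0] by simp
  then have "foldr coord_action xs 0 = 0" for xs :: "'v coord list"
    by (induction xs) simp_all
  then show ?thesis by (simp add: tensor_action_def word_action_def linear_extension_def)
qed

section \<open>Degrees and leading terms of the action\<close>

definition monomial_degree :: "('x \<Rightarrow>\<^sub>0 nat) \<Rightarrow> nat"
  where "monomial_degree m = (\<Sum>x\<in>Poly_Mapping.keys m. Poly_Mapping.lookup m x)"

lemma monomial_degree_add: "monomial_degree (m + n) = monomial_degree m + monomial_degree n"
  unfolding monomial_degree_def by (rule setsum_keys_plus_distrib) simp_all

lemma monomial_degree_diff_le: "monomial_degree (m - n) \<le> monomial_degree m"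
proof -
  have "monomial_degree (m - n) \<le> (\<Sum>x\<in>Poly_Mapping.keys (m - n). Poly_Mapping.lookup m x)"
    unfolding monomial_degree_def by (intro sum_mono) (simp add: lookup_minus)
  also have "\<dots> \<le> monomial_degree m"
    unfolding monomial_degree_def
    by (intro sum_mono2) (auto simp: in_keys_iff lookup_minus)
  finally show ?thesis .
qed

lemma monomial_degree_word_monomial: "monomial_degree (word_monomial w) = tensor_degree w"
proof -
  have "monomial_degree (\<Sum>x\<leftarrow>xs. Poly_Mapping.single x 1) = length xs" for xs :: "'x list"
    by (induction xs) (simp_all only: list.map sum_list.Cons sum_list.Nil monomial_degree_add,
        simp_all add: monomial_degree_def)
  then show ?thesis by (simp add: word_monomial_def)
qed

lemma word_monomial_plus: "word_monomial (u + v) = word_monomial u + word_monomial v"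
  by (simp add: word_monomial_def plus_word_def)

text \<open>
  The bound is strict so that it makes sense, and says that \<open>p = 0\<close>, also for \<open>n = 0\<close>.
\<close>

definition degree_below :: "nat \<Rightarrow> 'x polynomial \<Rightarrow> bool"
  where "degree_below n p \<longleftrightarrow> (\<forall>m. n \<le> monomial_degree m \<longrightarrow> Poly_Mapping.lookup p m = 0)"

lemma degree_below_zero [simp]: "degree_below n 0"
  by (simp add: degree_below_def)

lemma degree_below_add: "degree_below n p \<Longrightarrow> degree_below n q \<Longrightarrow> degree_below n (p + q)"
  by (simp add: degree_below_def lookup_add)

lemma degree_below_diff: "degree_below n p \<Longrightarrow> degree_below n q \<Longrightarrow> degree_below n (p - q)"
  by (simp add: degree_below_def lookup_minus)

lemma degree_below_sum: "(\<And>a. a \<in> A \<Longrightarrow> degree_below n (f a)) \<Longrightarrow> degree_below n (sum f A)"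
  by (simp add: degree_below_def lookup_sum)

lemma degree_below_mono: "degree_below n p \<Longrightarrow> n \<le> n' \<Longrightarrow> degree_below n' p"
  by (simp add: degree_below_def)

lemma degree_below_single: "degree_below n (Poly_Mapping.single m c) \<longleftrightarrow> c = 0 \<or> monomial_degree m < n"
  by (auto simp: degree_below_def lookup_single when_def not_less)

lemma monomial_degree_less_if_degree_below:
  "degree_below n p \<Longrightarrow> m \<in> Poly_Mapping.keys p \<Longrightarrow> monomial_degree m < n"
  unfolding degree_below_def in_keys_iff using not_less by blast

lemma degree_below_mult_single:
  assumes "degree_below n p"
  shows "degree_below (monomial_degree m + n) (Poly_Mapping.single m c * p)"
proof -
  have "Poly_Mapping.single m c * p = (\<Sum>w\<in>Poly_Mapping.keys p.
      Poly_Mapping.single (m + w) (c * Poly_Mapping.lookup p w))"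
    by (subst poly_mapping_eq_sum_single[of p]) (simp add: sum_distrib_left mult_single)
  moreover have "monomial_degree w < n" if "w \<in> Poly_Mapping.keys p" for w
    using assms that by (rule monomial_degree_less_if_degree_below)
  ultimately show ?thesis
    by (auto intro!: degree_below_sum simp: degree_below_single monomial_degree_add)
qed

lemma degree_below_scalar_mult: "degree_below n p \<Longrightarrow> degree_below n (scalar c * p)"
  using degree_below_mult_single[of n p 0 c] by (simp add: monomial_degree_def)

lemma degree_below_variable_mult: "degree_below n p \<Longrightarrow> degree_below (Suc n) (variable x * p)"
  using degree_below_mult_single[of n p "Poly_Mapping.single x 1" 1]
  by (simp add: monomial_degree_def variable_def)

lemma degree_below_partial_derivative:
  assumes "degree_below n p"
  shows "degree_below n (partial_derivative x p)"
  unfolding partial_derivative_def linear_extension_def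
proof (intro degree_below_sum degree_below_scalar_mult)
  fix m
  assume "m \<in> Poly_Mapping.keys p"
  with assms have "monomial_degree m < n" by (rule monomial_degree_less_if_degree_below)
  with monomial_degree_diff_le[of m "Poly_Mapping.single x 1"]
  have "monomial_degree (m - Poly_Mapping.single x 1) < n" by (rule le_less_trans)
  then show "degree_below n
      (Poly_Mapping.single (m - Poly_Mapping.single x 1) (of_nat (Poly_Mapping.lookup m x)))"
    by (simp only: degree_below_single simp_thms)
qed

text \<open>
  The derivative does not raise the degree, so it is of lower order than the product with
  the coordinate.
\<close>

lemma coord_action_leading_term:
  assumes "degree_below (Suc n) p"
  shows "degree_below (Suc n) (coord_action x p - variable x * p)"
  using degree_below_diff[OF degree_below_zero degree_below_partial_derivative[OF assms]]
  by (cases x) simp_all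

text \<open>
  By induction a product of \<open>n\<close> operators applied to \<open>1\<close> has degree at most \<open>n\<close>, so replacing the next
  operator by multiplication changes the result only in degrees at most \<open>n\<close>, below the new
  leading degree.
\<close>

lemma foldr_coord_action_leading_term:
  "degree_below (length xs) (foldr coord_action xs 1 - Poly_Mapping.single (word_monomial (Word xs)) 1)"
proof (induction xs)
  case Nil
  then show ?case by (simp add: word_monomial_def)
next
  case (Cons x xs)
  let ?M = "Poly_Mapping.single (word_monomial (Word xs)) 1"
  let ?p = "foldr coord_action xs 1"
  have "degree_below (Suc (length xs)) ((?p - ?M) + ?M)"
    using Cons by (intro degree_below_add)
      (simp_all add: degree_below_single monomial_degree_word_monomial degree_below_mono)
  then have "degree_below (Suc (length xs)) (coord_action x ?p - variable x * ?p)"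
    by (intro coord_action_leading_term) simp
  moreover have "degree_below (Suc (length xs)) (variable x * (?p - ?M))"
    using Cons by (rule degree_below_variable_mult)
  moreover have "Poly_Mapping.single (word_monomial (Word (x # xs))) 1 = variable x * ?M"
    by (simp add: word_monomial_def variable_def mult_single)
  ultimately have "degree_below (Suc (length xs)) ((coord_action x ?p - variable x * ?p) +
    variable x * (?p - ?M))" by (intro degree_below_add)
  then show ?case
    using \<open>Poly_Mapping.single _ 1 = variable x * ?M\<close> by (simp add: right_diff_distrib)
qed

lemma sym_component_linear_extension:
  "sym_component k = linear_extension
    (\<lambda>w. if tensor_degree w = k then Poly_Mapping.single (word_monomial w) 1 else 0)"
proof
  fix x :: "'x word \<Rightarrow>\<^sub>0 complex"
  show "sym_component k x = linear_extension
      (\<lambda>w. if tensor_degree w = k then Poly_Mapping.single (word_monomial w) 1 else 0) x"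
    unfolding sym_component_def linear_extension_def
    by (intro sum.mono_neutral_cong_left) (auto simp: mult_single)
qed

lemma sym_component_homogeneous:
  assumes "monomial_degree m \<noteq> k"
  shows "Poly_Mapping.lookup (sym_component k x) m = 0"
  using assms
  by (auto simp: sym_component_def lookup_sum lookup_single when_def monomial_degree_word_monomial
      intro!: sum.neutral)

lemma tensor_action_leading_term:
  assumes "\<forall>w\<in>Poly_Mapping.keys x. tensor_degree w \<le> k"
  shows "degree_below k (tensor_action x 1 - sym_component k x)"
proof -
  have "degree_below k (word_action w 1 -
      (if tensor_degree w = k then Poly_Mapping.single (word_monomial w) 1 else 0))"
    if "w \<in> Poly_Mapping.keys x" for w
  proof (cases "tensor_degree w = k")
    case True
    then show ?thesis using foldr_coord_action_leading_term[of "letters w"]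
      by (simp add: word_action_def)
  next
    case False
    with assms that have less: "tensor_degree w < k" by fastforce
    have "degree_below k (word_action w 1 - Poly_Mapping.single (word_monomial w) 1)"
      using degree_below_mono[OF foldr_coord_action_leading_term[of "letters w"], of k] less
      by (simp add: word_action_def)
    moreover have "degree_below k (Poly_Mapping.single (word_monomial w) 1)"
      using less by (simp add: degree_below_single monomial_degree_word_monomial)
    ultimately have "degree_below k (word_action w 1 - Poly_Mapping.single (word_monomial w) 1
        + Poly_Mapping.single (word_monomial w) 1)" by (rule degree_below_add)
    with False show ?thesis by simp
  qed
  then have "degree_below k (\<Sum>w\<in>Poly_Mapping.keys x. scalar (Poly_Mapping.lookup x w) *
      (word_action w 1 -
        (if tensor_degree w = k then Poly_Mapping.single (word_monomial w) 1 else 0)))"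
    by (intro degree_below_sum degree_below_scalar_mult)
  then show ?thesis
    by (simp only: tensor_action_def sym_component_linear_extension linear_extension_def
        right_diff_distrib sum_subtractf)
qed

text \<open>
  The core of the Poincare-Birkhoff-Witt property: applied to the constant polynomial \<open>1\<close>, a tensor
  of degree at most \<open>k\<close> gives its component of degree \<open>k\<close> in the symmetric algebra plus terms of
  degree less than \<open>k\<close>, so the two parts cannot cancel.
\<close>

lemma sym_component_eq_zero_if_acts_trivially:
  assumes "\<forall>w\<in>Poly_Mapping.keys x. tensor_degree w \<le> k" and "tensor_action x 1 = 0"
  shows "sym_component k x = 0"
proof (rule poly_mapping_eqI)
  fix m
  show "Poly_Mapping.lookup (sym_component k x) m = Poly_Mapping.lookup 0 m"
    using tensor_action_leading_term[OF assms(1)] sym_component_homogeneous[of m k x]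
    by (cases "monomial_degree m = k") (auto simp: assms(2) degree_below_def lookup_minus)
qed

text \<open>
  With the degrees bounded by \<open>k\<close> and \<open>l\<close>, the only products of words of degree \<open>k + l\<close> are those
  of words of degree \<open>k\<close> with words of degree \<open>l\<close>.
\<close>

lemma sym_component_mult:
  assumes x: "\<forall>w\<in>Poly_Mapping.keys x. tensor_degree w \<le> k"
    and y: "\<forall>w\<in>Poly_Mapping.keys y. tensor_degree w \<le> l"
  shows "sym_component (k + l) (x * y) = sym_component k x * sym_component l y"
proof -
  let ?g = "\<lambda>k w. if tensor_degree w = k then Poly_Mapping.single (word_monomial w) 1 else 0 :: 'a polynomial"
  have "?g (k + l) (u + v) = ?g k u * ?g l v"
    if "u \<in> Poly_Mapping.keys x" "v \<in> Poly_Mapping.keys y" for u v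
  proof -
    have "tensor_degree u \<le> k" "tensor_degree v \<le> l" using x y that by auto
    then show ?thesis by (auto simp: plus_word_def word_monomial_plus[unfolded plus_word_def] mult_single)
  qed
  then have "sym_component (k + l) (x * y) = (\<Sum>u\<in>Poly_Mapping.keys x. \<Sum>v\<in>Poly_Mapping.keys y.
      scalar (Poly_Mapping.lookup x u * Poly_Mapping.lookup y v) * (?g k u * ?g l v))"
    unfolding sym_component_linear_extension linear_extension_mult
    by (intro sum.cong) simp_all
  also have "\<dots> = (\<Sum>u\<in>Poly_Mapping.keys x. \<Sum>v\<in>Poly_Mapping.keys y.
      (scalar (Poly_Mapping.lookup x u) * ?g k u) * (scalar (Poly_Mapping.lookup y v) * ?g l v))"
    by (intro sum.cong refl) (simp add: mult_single mult_ac)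
  also have "\<dots> = sym_component k x * sym_component l y"
    unfolding sym_component_linear_extension linear_extension_def sum_product ..
  finally show ?thesis .
qed

section \<open>The Weyl algebra and uniqueness of symbols\<close>

context simply_laced
begin

lemma tensor_algebra_simps [simp]:
  "mult tensor_algebra = (*)" "one tensor_algebra = 1"
  "zero tensor_algebra = 0" "add tensor_algebra = (+)"
  by (simp_all add: tensor_algebra_def)

lemma carrier_tensor_algebra_iff:
  "x \<in> carrier tensor_algebra \<longleftrightarrow>
    (\<forall>w. Poly_Mapping.lookup x w \<noteq> 0 \<longrightarrow> set (letters w) \<subseteq> coords)"
  by (auto simp: tensor_algebra_def in_keys_iff)

lemma tensors_upto_iff:
  "x \<in> tensors_upto k \<longleftrightarrow> x \<in> carrier tensor_algebra \<and>
    (\<forall>w. Poly_Mapping.lookup x w \<noteq> 0 \<longrightarrow> tensor_degree w \<le> k)"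
  by (auto simp: tensors_upto_def in_keys_iff)

lemma tensors_upto_carrier: "x \<in> tensors_upto k \<Longrightarrow> x \<in> carrier tensor_algebra"
  by (simp add: tensors_upto_def)

lemma carrier_tensor_algebra_add:
  "x \<in> carrier tensor_algebra \<Longrightarrow> y \<in> carrier tensor_algebra \<Longrightarrow> x + y \<in> carrier tensor_algebra"
  by (auto simp: tensor_algebra_def dest!: subsetD[OF Poly_Mapping.keys_add])

lemma carrier_tensor_algebra_uminus:
  "x \<in> carrier tensor_algebra \<Longrightarrow> - x \<in> carrier tensor_algebra"
  by (simp add: carrier_tensor_algebra_iff)

lemma carrier_tensor_algebra_mult:
  assumes "x \<in> carrier tensor_algebra" "y \<in> carrier tensor_algebra"
  shows "x * y \<in> carrier tensor_algebra"
  using assms Poly_Mapping.keys_mult[of x y] by (fastforce simp: tensor_algebra_def plus_word_def)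

lemma carrier_tensor_algebra_scalar: "scalar_tensor c \<in> carrier tensor_algebra"
  by (simp add: carrier_tensor_algebra_iff lookup_single when_def zero_word_def)

lemma ring_tensor_algebra: "ring tensor_algebra"
proof (intro ringI abelian_groupI monoidI)
  fix x assume "x \<in> carrier tensor_algebra"
  then show "\<exists>y\<in>carrier tensor_algebra. y \<oplus>\<^bsub>tensor_algebra\<^esub> x = \<zero>\<^bsub>tensor_algebra\<^esub>"
    by (intro bexI[of _ "- x"]) (simp_all add: carrier_tensor_algebra_uminus)
next
  show "\<zero>\<^bsub>tensor_algebra\<^esub> \<in> carrier tensor_algebra"
    using carrier_tensor_algebra_scalar[of 0] by simp
  show "\<one>\<^bsub>tensor_algebra\<^esub> \<in> carrier tensor_algebra"
    using carrier_tensor_algebra_scalar[of 1] by simp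
qed (simp_all add: carrier_tensor_algebra_add carrier_tensor_algebra_mult algebra_simps)

sublocale T: ring tensor_algebra
  by (rule ring_tensor_algebra)

lemma tensors_upto_add: "x \<in> tensors_upto k \<Longrightarrow> y \<in> tensors_upto k \<Longrightarrow> x + y \<in> tensors_upto k"
  using Poly_Mapping.keys_add[of x y] carrier_tensor_algebra_add[of x y] 
  by (auto simp: tensors_upto_def)

lemma tensors_upto_uminus: "x \<in> tensors_upto k \<Longrightarrow> - x \<in> tensors_upto k"
  by (simp add: tensors_upto_iff carrier_tensor_algebra_uminus)

lemma tensors_upto_mult:
  assumes "x \<in> tensors_upto k" "y \<in> tensors_upto l"
  shows "x * y \<in> tensors_upto (k + l)"
  using assms Poly_Mapping.keys_mult[of x y] carrier_tensor_algebra_mult[of x y]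
  by (fastforce simp: tensors_upto_def plus_word_def)

lemma weyl_relations_subset: "weyl_relations \<subseteq> carrier tensor_algebra"
  unfolding weyl_relations_def
  using carrier_tensor_algebra_add[OF _ carrier_tensor_algebra_uminus]
  by (auto simp: linear_functions_def carrier_tensor_algebra_scalar carrier_tensor_algebra_mult)

lemma ideal_weyl_ideal: "ideal weyl_ideal tensor_algebra"
  unfolding weyl_ideal_def by (rule T.genideal_ideal[OF weyl_relations_subset])

text \<open>
  The relation is bilinear in \<open>f\<close> and \<open>g\<close>, which reduces it to the commutator of the
  operators of two coordinates.
\<close>

lemma tensor_action_relation:
  assumes "f \<in> linear_functions" "g \<in> linear_functions"
  shows "tensor_action (f * g - g * f - scalar_tensor (linear_bracket f g)) p = 0"
proof -
  have act: "word_action w q = coord_action (hd (letters w)) q" if "tensor_degree w = 1" for w :: "'v coord word" and q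
    using that by (cases w) (auto simp: word_action_def length_Suc_conv)
  have linear: "tensor_action h q = (\<Sum>w\<in>Poly_Mapping.keys h. scalar (Poly_Mapping.lookup h w) *
      coord_action (hd (letters w)) q)" if "h \<in> linear_functions" for h q
    using that unfolding tensor_action_def linear_extension_def
    by (intro sum.cong) (auto simp: linear_functions_def act)
  have product: "tensor_action (h * h') p = (\<Sum>u\<in>Poly_Mapping.keys h. \<Sum>v\<in>Poly_Mapping.keys h'.
      scalar (Poly_Mapping.lookup h u * Poly_Mapping.lookup h' v) *
        coord_action (hd (letters u)) (coord_action (hd (letters v)) p))"
    if "h \<in> linear_functions" "h' \<in> linear_functions" for h h'
    using that unfolding tensor_action_def linear_extension_mult word_action_plus
    by (intro sum.cong refl) (simp add: linear_functions_def act)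
  have "tensor_action (f * g) p - tensor_action (g * f) p
      = (\<Sum>u\<in>Poly_Mapping.keys f. \<Sum>v\<in>Poly_Mapping.keys g.
          scalar (Poly_Mapping.lookup f u * Poly_Mapping.lookup g v) *
          (coord_action (hd (letters u)) (coord_action (hd (letters v)) p)
            - coord_action (hd (letters v)) (coord_action (hd (letters u)) p)))"
    \<comment> \<open>In the second product the sums are exchanged, so that both run over \<open>f\<close> first.\<close>
    unfolding product[OF assms] product[OF assms(2,1)]
    by (subst (2) sum.swap) (simp add: sum_subtractf right_diff_distrib mult.commute)
  also have "\<dots> = scalar (linear_bracket f g) * p"
    by (simp add: coord_action_commutator linear_bracket_def mult_single
        mult.assoc[symmetric] scalar_sum sum_distrib_right)
  finally show ?thesis
    unfolding tensor_action_def linear_extension_diff linear_extension_single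
    by (simp add: word_action_def zero_word_def)
qed

text \<open>
  The tensors that act as zero on all polynomials form a two-sided ideal, which contains the
  defining relations.
\<close>

lemma weyl_ideal_acts_trivially:
  assumes "x \<in> weyl_ideal"
  shows "tensor_action x p = 0"
proof -
  let ?J = "{x \<in> carrier tensor_algebra. \<forall>p. tensor_action x p = 0}"
  have inv: "\<ominus>\<^bsub>tensor_algebra\<^esub> x = - x" if "x \<in> carrier tensor_algebra" for x
    using that T.minus_equality[of "- x" x] carrier_tensor_algebra_uminus[of x] by simp
  have "ideal ?J tensor_algebra"
  proof (rule idealI[OF ring_tensor_algebra])
    show "subgroup ?J (add_monoid tensor_algebra)"
    proof (rule T.add.subgroupI)
      show "?J \<noteq> {}" using T.zero_closed by (auto simp: tensor_action_def)
    next
      fix a assume "a \<in> ?J"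
      then show "\<ominus>\<^bsub>tensor_algebra\<^esub> a \<in> ?J"
        by (auto simp: inv carrier_tensor_algebra_uminus tensor_action_def linear_extension_uminus)
    next
      fix a b assume "a \<in> ?J" "b \<in> ?J"
      then show "a \<oplus>\<^bsub>tensor_algebra\<^esub> b \<in> ?J"
        by (auto simp: carrier_tensor_algebra_add tensor_action_def linear_extension_add)
    qed auto
  qed (auto simp: tensor_action_mult carrier_tensor_algebra_mult)
  moreover have "weyl_relations \<subseteq> ?J"
    using weyl_relations_subset tensor_action_relation
    by (auto simp: weyl_relations_def)
  ultimately have "weyl_ideal \<subseteq> ?J"
    unfolding weyl_ideal_def by (rule T.genideal_minimal)
  with assms show ?thesis by auto
qed

lemma ring_weyl: "ring weyl"
  unfolding weyl_def by (rule ideal.quotient_is_ring[OF ideal_weyl_ideal])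

sublocale W: ring weyl
  by (rule ring_weyl)

lemma to_weyl_hom: "to_weyl \<in> ring_hom tensor_algebra weyl"
  unfolding weyl_def using ideal.rcos_ring_hom[OF ideal_weyl_ideal]
  by (simp add: to_weyl_def[abs_def])

lemma to_weyl_closed: "x \<in> carrier tensor_algebra \<Longrightarrow> to_weyl x \<in> carrier weyl"
  by (rule ring_hom_closed[OF to_weyl_hom])

lemma to_weyl_add:
  "x \<in> carrier tensor_algebra \<Longrightarrow> y \<in> carrier tensor_algebra \<Longrightarrow>
    to_weyl (x + y) = to_weyl x \<oplus>\<^bsub>weyl\<^esub> to_weyl y"
  using ring_hom_add[OF to_weyl_hom] by simp

lemma to_weyl_mult:
  "x \<in> carrier tensor_algebra \<Longrightarrow> y \<in> carrier tensor_algebra \<Longrightarrow>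
    to_weyl (x * y) = to_weyl x \<otimes>\<^bsub>weyl\<^esub> to_weyl y"
  using ring_hom_mult[OF to_weyl_hom] by simp

lemma to_weyl_zero: "to_weyl 0 = \<zero>\<^bsub>weyl\<^esub>"
  using ring_hom_zero[OF to_weyl_hom ring_tensor_algebra ring_weyl] by simp

lemma to_weyl_uminus:
  assumes "x \<in> carrier tensor_algebra"
  shows "to_weyl (- x) = \<ominus>\<^bsub>weyl\<^esub> to_weyl x"
proof -
  have "to_weyl (- x) \<oplus>\<^bsub>weyl\<^esub> to_weyl x = \<zero>\<^bsub>weyl\<^esub>"
    using to_weyl_add[OF carrier_tensor_algebra_uminus[OF assms] assms] by (simp add: to_weyl_zero)
  then show ?thesis
    using assms by (intro W.minus_equality[symmetric] to_weyl_closed carrier_tensor_algebra_uminus)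
qed

text \<open>
  The description under which \<^const>\<open>weyl_symbol\<close> selects its value. Working with this relation
  separates the question of uniqueness from the computation of symbols, and turns the latter into structural rules for
  sums, products and traces.
\<close>

definition has_symbol :: "nat \<Rightarrow> 'v tensor set \<Rightarrow> 'v coord polynomial \<Rightarrow> bool"
  where "has_symbol k a s \<longleftrightarrow> (\<exists>x\<in>tensors_upto k. to_weyl x = a \<and> s = sym_component k x)"

text \<open>
  Two representatives of the same class differ by an element of the ideal, which acts as zero;
  hence the difference has no component of degree \<open>k\<close>.
\<close>

lemma has_symbol_unique:
  assumes "has_symbol k a s" "has_symbol k a t"
  shows "s = t"
proof -
  obtain x where x: "x \<in> tensors_upto k" "to_weyl x = a" "s = sym_component k x"
    using assms(1) by (auto simp: has_symbol_def)
  obtain y where y: "y \<in> tensors_upto k" "to_weyl y = a" "t = sym_component k y"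
    using assms(2) by (auto simp: has_symbol_def)
  have upto: "x + - y \<in> tensors_upto k"
    by (intro tensors_upto_add tensors_upto_uminus x y)
  have "a \<in> carrier weyl" using x to_weyl_closed tensors_upto_carrier by auto
  then have "to_weyl (x + - y) = \<zero>\<^bsub>weyl\<^esub>"
    using x y tensors_upto_carrier[OF x(1)] tensors_upto_carrier[OF y(1)]
    by (simp add: to_weyl_add carrier_tensor_algebra_uminus to_weyl_uminus W.r_neg
       del: add_uminus_conv_diff)
  then have "x + - y \<in> weyl_ideal"
    using tensors_upto_carrier[OF upto] ideal.rcos_const_imp_mem[OF ideal_weyl_ideal]
    by (simp add: to_weyl_def weyl_def FactRing_def)
  then have "sym_component k (x + - y) = 0"
    using upto by (intro sym_component_eq_zero_if_acts_trivially)
      (auto simp: tensors_upto_def weyl_ideal_acts_trivially)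
  then show ?thesis
    using x y by (simp add: sym_component_linear_extension linear_extension_diff)
qed

lemma weyl_symbol_eq: "has_symbol k a s \<Longrightarrow> weyl_symbol k a = s"
  unfolding weyl_symbol_def
  using has_symbol_unique by (intro the_equality) (auto simp: has_symbol_def)

end

section \<open>Matrices over a commutative ring\<close>

text \<open>
  Matrices of symbols have commuting entries, so that, unlike over the Weyl algebra, traces
  of their products are cyclic. The bounds of the indices are passed as arguments, since only the values of
  the functions below them matter.
\<close>

definition symbol_mult ::
    "nat \<Rightarrow> (nat \<Rightarrow> nat \<Rightarrow> 'r) \<Rightarrow> (nat \<Rightarrow> nat \<Rightarrow> 'r) \<Rightarrow> (nat \<Rightarrow> nat \<Rightarrow> 'r::comm_semiring_0)"
  where "symbol_mult m S T = (\<lambda>r s. \<Sum>t<m. S r t * T t s)"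

definition symbol_trace :: "nat \<Rightarrow> (nat \<Rightarrow> nat \<Rightarrow> 'r) \<Rightarrow> 'r::comm_semiring_0"
  where "symbol_trace n S = (\<Sum>r<n. S r r)"

lemma symbol_mult_assoc:
  "symbol_mult n (symbol_mult m S T) U = symbol_mult m S (symbol_mult n T U)"
  unfolding symbol_mult_def sum_distrib_left sum_distrib_right
  by (intro ext, subst sum.swap) (simp add: mult.assoc)

lemma symbol_trace_commute:
  "symbol_trace n (symbol_mult m S T) = symbol_trace m (symbol_mult n T S)"
  unfolding symbol_mult_def symbol_trace_def by (subst sum.swap) (simp add: mult.commute)

section \<open>The calculus of symbols\<close>

context simply_laced
begin

lemma has_symbol_closed: "has_symbol k a s \<Longrightarrow> a \<in> carrier weyl"
  by (auto simp: has_symbol_def intro: to_weyl_closed tensors_upto_carrier)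

lemma has_symbol_zero: "has_symbol k \<zero>\<^bsub>weyl\<^esub> 0"
  unfolding has_symbol_def
  by (intro bexI[of _ 0])
    (simp_all add: to_weyl_zero sym_component_def tensors_upto_iff carrier_tensor_algebra_iff)

lemma has_symbol_add:
  assumes "has_symbol k a s" "has_symbol k b t"
  shows "has_symbol k (a \<oplus>\<^bsub>weyl\<^esub> b) (s + t)"
proof -
  obtain x y where "x \<in> tensors_upto k" "to_weyl x = a" "s = sym_component k x"
    "y \<in> tensors_upto k" "to_weyl y = b" "t = sym_component k y"
    using assms by (auto simp: has_symbol_def)
  then show ?thesis unfolding has_symbol_def
    by (intro bexI[of _ "x + y"])
      (simp_all add: to_weyl_add tensors_upto_carrier tensors_upto_add
        sym_component_linear_extension linear_extension_add)
qed

lemma has_symbol_uminus: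
  assumes "has_symbol k a s"
  shows "has_symbol k (\<ominus>\<^bsub>weyl\<^esub> a) (- s)"
proof -
  obtain x where "x \<in> tensors_upto k" "to_weyl x = a" "s = sym_component k x"
    using assms by (auto simp: has_symbol_def)
  then show ?thesis unfolding has_symbol_def
    by (intro bexI[of _ "- x"])
      (simp_all add: to_weyl_uminus tensors_upto_carrier tensors_upto_uminus
        sym_component_linear_extension linear_extension_uminus)
qed

lemma has_symbol_mult:
  assumes "has_symbol k a s" "has_symbol l b t"
  shows "has_symbol (k + l) (a \<otimes>\<^bsub>weyl\<^esub> b) (s * t)"
proof -
  obtain x y where xy: "x \<in> tensors_upto k" "to_weyl x = a" "s = sym_component k x"
    "y \<in> tensors_upto l" "to_weyl y = b" "t = sym_component l y"
    using assms by (auto simp: has_symbol_def)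
  moreover have "sym_component (k + l) (x * y) = sym_component k x * sym_component l y"
    using xy by (intro sym_component_mult) (auto simp: tensors_upto_def)
  ultimately show ?thesis unfolding has_symbol_def
    by (intro bexI[of _ "x * y"])
      (simp_all add: to_weyl_mult tensors_upto_carrier tensors_upto_mult)
qed

lemma has_symbol_letter:
  assumes "x \<in> coords"
  shows "has_symbol 1 (to_weyl (letter_tensor x)) (variable x)"
  unfolding has_symbol_def using assms
  by (intro bexI[of _ "letter_tensor x"])
    (simp_all add: sym_component_linear_extension word_monomial_def variable_def mult_single
      tensors_upto_iff carrier_tensor_algebra_iff lookup_single when_def)

lemma has_symbol_scale:
  assumes "has_symbol k a s"
  shows "has_symbol k (c *\<^sub>W a) (scalar c * s)"
proof -
  have "has_symbol 0 (to_weyl (scalar_tensor c)) (scalar c)"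
    unfolding has_symbol_def
    by (intro bexI[of _ "scalar_tensor c"])
      (simp_all add: sym_component_linear_extension word_monomial_def zero_word_def mult_single
        tensors_upto_iff carrier_tensor_algebra_iff lookup_single when_def)
  from has_symbol_mult[OF this assms] show ?thesis by (simp add: weyl_scale_def)
qed

lemma has_symbol_finsum:
  assumes "finite A" and "\<And>a. a \<in> A \<Longrightarrow> has_symbol k (f a) (g a)"
  shows "has_symbol k (\<Oplus>\<^bsub>weyl\<^esub>a\<in>A. f a) (\<Sum>a\<in>A. g a)"
  using assms
proof (induction A)
  case empty
  then show ?case by (simp add: has_symbol_zero)
next
  case (insert a A)
  then have "(\<Oplus>\<^bsub>weyl\<^esub>b\<in>insert a A. f b) = f a \<oplus>\<^bsub>weyl\<^esub> (\<Oplus>\<^bsub>weyl\<^esub>b\<in>A. f b)"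
    by (intro W.finsum_insert) (auto intro: has_symbol_closed)
  with insert show ?case by (simp add: has_symbol_add)
qed

definition has_matrix_symbol ::
    "nat \<Rightarrow> nat \<Rightarrow> nat \<Rightarrow> 'v tensor set matrix \<Rightarrow> (nat \<Rightarrow> nat \<Rightarrow> 'v coord polynomial) \<Rightarrow> bool"
  where "has_matrix_symbol k n m X S \<longleftrightarrow> nrows X = n \<and> ncols X = m \<and>
    (\<forall>r<n. \<forall>s<m. has_symbol k (entry X r s) (S r s))"

lemma has_matrix_symbol_mult:
  assumes "has_matrix_symbol k n m X S" "has_matrix_symbol l m p Y T"
  shows "has_matrix_symbol (k + l) n p (X \<bullet>\<^bsub>weyl\<^esub> Y) (symbol_mult m S T)"
  using assms unfolding has_matrix_symbol_def matrix_mult_def symbol_mult_def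
  by (auto intro!: has_symbol_finsum has_symbol_mult)

lemma has_symbol_trace:
  assumes "has_matrix_symbol k n n X S"
  shows "has_symbol k (Tr\<^bsub>weyl\<^esub> X) (symbol_trace n S)"
  using assms unfolding has_matrix_symbol_def matrix_trace_def symbol_trace_def
  by (auto intro!: has_symbol_finsum)

section \<open>Traces along cycles\<close>

definition Q_symbol :: "'v \<Rightarrow> 'v \<Rightarrow> nat \<Rightarrow> nat \<Rightarrow> 'v coord polynomial"
  where "Q_symbol j i = (\<lambda>r s. variable (Q_coord j r i s))"

definition P_symbol :: "'v \<Rightarrow> 'v \<Rightarrow> nat \<Rightarrow> nat \<Rightarrow> 'v coord polynomial"
  where "P_symbol i j = (\<lambda>s r. variable (P_coord i s j r))"

lemma has_matrix_symbol_Qh: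
  assumes "j \<in> I0" "i \<in> Iinf"
  shows "has_matrix_symbol 1 (d j) (d i) (Qh j i) (Q_symbol j i)"
  using assms unfolding has_matrix_symbol_def Qh_def Q_symbol_def
  by (auto intro!: has_symbol_letter[simplified] simp: coords_def)

lemma has_matrix_symbol_Ph:
  assumes "j \<in> I0" "i \<in> Iinf"
  shows "has_matrix_symbol 1 (d i) (d j) (Ph i j) (P_symbol i j)"
  using assms unfolding has_matrix_symbol_def Ph_def P_symbol_def
  by (auto intro!: has_symbol_letter[simplified] simp: coords_def)

text \<open>
  The traces of symbols along the cycles of length two and four of the complete bipartite
  graph: \<open>two_cycle j i\<close> is the trace of \<open>Q\<^sub>j\<^sub>i P\<^sub>i\<^sub>j\<close>, and \<open>four_cycle j i l k\<close> the trace of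
  \<open>Q\<^sub>j\<^sub>i P\<^sub>i\<^sub>l Q\<^sub>l\<^sub>k P\<^sub>k\<^sub>j\<close>.
\<close>

definition two_cycle :: "'v \<Rightarrow> 'v \<Rightarrow> 'v coord polynomial"
  where "two_cycle j i = symbol_trace (d j) (symbol_mult (d i) (Q_symbol j i) (P_symbol i j))"

definition four_cycle :: "'v \<Rightarrow> 'v \<Rightarrow> 'v \<Rightarrow> 'v \<Rightarrow> 'v coord polynomial"
  where "four_cycle j i l k = symbol_trace (d j)
    (symbol_mult (d k) (symbol_mult (d l) (symbol_mult (d i)
      (Q_symbol j i) (P_symbol i l)) (Q_symbol l k)) (P_symbol k j))"

lemma four_cycle_rotate: "four_cycle j i l k = four_cycle l k j i"
proof -
  have "four_cycle j i l k = symbol_trace (d j)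
    (symbol_mult (d l) (symbol_mult (d i) (Q_symbol j i) (P_symbol i l))
      (symbol_mult (d k) (Q_symbol l k) (P_symbol k j)))"
    by (simp add: four_cycle_def symbol_mult_assoc)
  also have "\<dots> = four_cycle l k j i"
    by (subst symbol_trace_commute) (simp add: four_cycle_def symbol_mult_assoc)
  finally show ?thesis .
qed

lemma has_symbol_two_cycle_Q:
  assumes "j \<in> I0" "i \<in> Iinf"
  shows "has_symbol 2 (Tr\<^bsub>weyl\<^esub> (Qh j i \<bullet>\<^bsub>weyl\<^esub> Ph i j)) (two_cycle j i)"
  using has_symbol_trace[OF has_matrix_symbol_mult[OF has_matrix_symbol_Qh has_matrix_symbol_Ph]]
    assms by (simp add: two_cycle_def numeral_2_eq_2)

lemma has_symbol_two_cycle_P: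
  assumes "j \<in> I0" "i \<in> Iinf"
  shows "has_symbol 2 (Tr\<^bsub>weyl\<^esub> (Ph i j \<bullet>\<^bsub>weyl\<^esub> Qh j i)) (two_cycle j i)"
  using has_symbol_trace[OF has_matrix_symbol_mult[OF has_matrix_symbol_Ph has_matrix_symbol_Qh]]
    assms by (simp add: two_cycle_def numeral_2_eq_2 symbol_trace_commute[of "d j"])

lemma has_symbol_four_cycle_Q:
  assumes "j \<in> I0" "l \<in> I0" "i \<in> Iinf" "k \<in> Iinf"
  shows "has_symbol 4 (Tr\<^bsub>weyl\<^esub> (Qh j i \<bullet>\<^bsub>weyl\<^esub> Ph i l \<bullet>\<^bsub>weyl\<^esub> Qh l k \<bullet>\<^bsub>weyl\<^esub> Ph k j)) (four_cycle j i l k)"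
proof -
  have "has_matrix_symbol (1 + 1 + 1 + 1) (d j) (d j)
      (Qh j i \<bullet>\<^bsub>weyl\<^esub> Ph i l \<bullet>\<^bsub>weyl\<^esub> Qh l k \<bullet>\<^bsub>weyl\<^esub> Ph k j)
      (symbol_mult (d k) (symbol_mult (d l) (symbol_mult (d i)
        (Q_symbol j i) (P_symbol i l)) (Q_symbol l k)) (P_symbol k j))"
    using assms by (intro has_matrix_symbol_mult has_matrix_symbol_Qh has_matrix_symbol_Ph)
  from has_symbol_trace[OF this] show ?thesis by (simp add: four_cycle_def numeral_eq_Suc)
qed

lemma has_symbol_four_cycle_P:
  assumes "j \<in> I0" "l \<in> I0" "i \<in> Iinf" "k \<in> Iinf"
  shows "has_symbol 4 (Tr\<^bsub>weyl\<^esub> (Ph i l \<bullet>\<^bsub>weyl\<^esub> Qh l k \<bullet>\<^bsub>weyl\<^esub> Ph k j \<bullet>\<^bsub>weyl\<^esub> Qh j i)) (four_cycle j i l k)"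
proof -
  have "has_matrix_symbol (1 + 1 + 1 + 1) (d i) (d i)
      (Ph i l \<bullet>\<^bsub>weyl\<^esub> Qh l k \<bullet>\<^bsub>weyl\<^esub> Ph k j \<bullet>\<^bsub>weyl\<^esub> Qh j i)
      (symbol_mult (d j) (symbol_mult (d k) (symbol_mult (d l)
        (P_symbol i l) (Q_symbol l k)) (P_symbol k j)) (Q_symbol j i))"
    using assms by (intro has_matrix_symbol_mult has_matrix_symbol_Qh has_matrix_symbol_Ph)
  moreover have "symbol_trace (d i) (symbol_mult (d j) (symbol_mult (d k) (symbol_mult (d l)
        (P_symbol i l) (Q_symbol l k)) (P_symbol k j)) (Q_symbol j i)) = four_cycle j i l k"
    by (subst symbol_trace_commute) (simp add: four_cycle_def symbol_mult_assoc)
  ultimately show ?thesis using has_symbol_trace by (fastforce simp: numeral_eq_Suc)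
qed

section \<open>Symbols of power series\<close>

text \<open>
  The symbols of all coefficients are recorded separately, without summing them: for the
  Hamiltonians they agree already coefficient by coefficient. Almost
  all coefficients of the Hamiltonians are zero, which gives the growth condition
  of \<^const>\<open>weyl_hat\<close> because zero has order \<open>0\<close>.
\<close>

definition has_series_symbol ::
    "(nat \<Rightarrow> 'v tensor set) \<Rightarrow> (nat \<Rightarrow> 'v coord polynomial) \<Rightarrow> bool"
  where "has_series_symbol f S \<longleftrightarrow>
    (\<forall>k. has_symbol k (f k) (S k)) \<and> (\<forall>\<^sub>F k in sequentially. f k = \<zero>\<^bsub>weyl\<^esub>)"

lemma has_series_symbol_monom:
  assumes "has_symbol k a s"
  shows "has_series_symbol (a \<hbar>^ k) (\<lambda>n. if n = k then s else 0)"
proof -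
  have "\<forall>\<^sub>F n in sequentially. (a \<hbar>^ k) n = \<zero>\<^bsub>weyl\<^esub>"
    using eventually_gt_at_top[of k] by (rule eventually_mono) (simp add: hbar_monom_def)
  with assms show ?thesis by (simp add: has_series_symbol_def hbar_monom_def has_symbol_zero)
qed

lemma has_series_symbol_add:
  assumes "has_series_symbol f S" "has_series_symbol g T"
  shows "has_series_symbol (f \<oplus>\<^sub>\<hbar> g) (\<lambda>n. S n + T n)"
proof -
  have "\<forall>\<^sub>F k in sequentially. f k = \<zero>\<^bsub>weyl\<^esub> \<and> g k = \<zero>\<^bsub>weyl\<^esub>"
    using assms by (simp add: has_series_symbol_def eventually_conj)
  then have "\<forall>\<^sub>F k in sequentially. (f \<oplus>\<^sub>\<hbar> g) k = \<zero>\<^bsub>weyl\<^esub>"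
    by (rule eventually_mono) (simp add: series_add_def)
  with assms show ?thesis by (simp add: has_series_symbol_def series_add_def has_symbol_add)
qed

lemma has_series_symbol_uminus:
  assumes "has_series_symbol f S"
  shows "has_series_symbol (series_uminus f) (\<lambda>n. - S n)"
  using assms
  by (auto simp: has_series_symbol_def series_uminus_def has_symbol_uminus elim: eventually_mono)

lemma has_series_symbol_minus:
  assumes "has_series_symbol f S" "has_series_symbol g T"
  shows "has_series_symbol (series_minus f g) (\<lambda>n. S n - T n)"
proof -
  have "series_minus f g = f \<oplus>\<^sub>\<hbar> series_uminus g"
    by (simp add: series_minus_def series_add_def series_uminus_def a_minus_def)
  then show ?thesis
    using has_series_symbol_add[OF assms(1) has_series_symbol_uminus[OF assms(2)]] by simp
qed

text \<open>
  All coefficients contribute to the semiclassical limit through \<^const>\<open>weyl_symbol\<close>, also those that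
  vanish; uniqueness of symbols shows that each contribution is zero.
\<close>

lemma semiclassical_kernel_if_symbol_zero:
  assumes "has_series_symbol f (\<lambda>_. 0)"
  shows "f \<in> semiclassical_kernel"
proof -
  have "f k \<in> weyl_upto k" for k
    using assms by (force simp: has_series_symbol_def has_symbol_def weyl_upto_def)
  moreover have "filterlim (\<lambda>k. int k - int (weyl_order (f k))) at_top sequentially"
  proof -
    have "weyl_order \<zero>\<^bsub>weyl\<^esub> = 0"
      unfolding weyl_order_def using has_symbol_zero[of 0]
      by (intro Least_equality) (auto simp: weyl_upto_def has_symbol_def)
    then have "\<forall>\<^sub>F k in sequentially. int k = int k - int (weyl_order (f k))"
      using assms by (auto simp: has_series_symbol_def elim: eventually_mono)
    from filterlim_cong[THEN iffD1, OF refl refl this filterlim_int_sequentially]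
    show ?thesis .
  qed
  moreover have "weyl_symbol k (f k) = 0" for k
    using assms by (intro weyl_symbol_eq) (simp add: has_series_symbol_def)
  ultimately show ?thesis
    by (simp add: semiclassical_kernel_def weyl_hat_def semiclassical_limit_def)
qed

section \<open>Comparison of the Hamiltonians\<close>

text \<open>
  The classical Hamiltonians, as sums over all four-cycles and two-cycles through a given
  node.
\<close>

definition Hamiltonian_inf_symbol :: "'v point \<Rightarrow> 'v \<Rightarrow> nat \<Rightarrow> 'v coord polynomial"
  where "Hamiltonian_inf_symbol = (\<lambda>(tinf, t0) i n.
    (if n = 4 then \<Sum>k\<in>Iinf - {i}. \<Sum>j\<in>I0. \<Sum>l\<in>I0.
      scalar (1 / (tinf i - tinf k)) * four_cycle j i l k else 0) +
    (if n = 2 then \<Sum>j\<in>I0. scalar (t0 j) * two_cycle j i else 0))"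

definition Hamiltonian_zero_symbol :: "'v point \<Rightarrow> 'v \<Rightarrow> nat \<Rightarrow> 'v coord polynomial"
  where "Hamiltonian_zero_symbol = (\<lambda>(tinf, t0) j n.
    (if n = 4 then \<Sum>l\<in>I0 - {j}. \<Sum>i\<in>Iinf. \<Sum>k\<in>Iinf.
      scalar (1 / (t0 j - t0 l)) * four_cycle j i l k else 0) +
    (if n = 2 then \<Sum>i\<in>Iinf. scalar (tinf i) * two_cycle j i else 0))"

lemma has_series_symbol_FMTV_inf:
  assumes "finite I0" "finite Iinf" "i \<in> Iinf"
  shows "has_series_symbol (FMTV_inf p i) (Hamiltonian_inf_symbol p i)"
  unfolding FMTV_inf_def Hamiltonian_inf_symbol_def split_beta using assms
  by (intro has_series_symbol_add has_series_symbol_monom has_symbol_finsum has_symbol_scale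
      has_symbol_four_cycle_Q has_symbol_two_cycle_Q) auto

lemma has_series_symbol_FMTV_zero:
  assumes "finite I0" "finite Iinf" "j \<in> I0"
  shows "has_series_symbol (FMTV_zero p j) (Hamiltonian_zero_symbol p j)"
  unfolding FMTV_zero_def Hamiltonian_zero_symbol_def split_beta using assms
  by (intro has_series_symbol_add has_series_symbol_monom has_symbol_finsum has_symbol_scale
      has_symbol_four_cycle_Q has_symbol_two_cycle_Q) auto

lemma scalar_half_double: "scalar (1 / 2) * (s + s) = s"
proof -
  have "scalar (1 / 2) * (s + s) = scalar (1 / 2 + 1 / 2) * s"
    by (simp only: single_add distrib_left distrib_right)
  then show ?thesis by simp
qed

text \<open>
  The average of the two orderings of a quadratic term has the same symbol as either of them.
\<close>

lemma has_symbol_symmetrized: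
  assumes "finite A"
    and "\<And>a. a \<in> A \<Longrightarrow> has_symbol k (f a) (s a)" "\<And>a. a \<in> A \<Longrightarrow> has_symbol k (g a) (s a)"
  shows "has_symbol k ((1 / 2) *\<^sub>W (\<Oplus>\<^bsub>weyl\<^esub>a\<in>A. t a *\<^sub>W (f a \<oplus>\<^bsub>weyl\<^esub> g a)))
    (\<Sum>a\<in>A. scalar (t a) * s a)"
proof -
  have "has_symbol k ((1 / 2) *\<^sub>W (\<Oplus>\<^bsub>weyl\<^esub>a\<in>A. t a *\<^sub>W (f a \<oplus>\<^bsub>weyl\<^esub> g a)))
      (scalar (1 / 2) * (\<Sum>a\<in>A. scalar (t a) * (s a + s a)))"
    using assms by (intro has_symbol_scale has_symbol_finsum has_symbol_add)
  then show ?thesis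
    by (simp only: scalar_half_double distrib_left[of "scalar (t _)"] sum.distrib)
qed

text \<open>
  The quartic terms split into those with \<open>j \<noteq> l\<close> and the degenerate cycles with \<open>j = l\<close>; together
  they give the unrestricted sum over \<open>j\<close> and \<open>l\<close>. In the degenerate terms the trace
  starts at the other of the two visits to \<open>j\<close>, so the cycle has to be rotated.
\<close>

lemma has_series_symbol_H_inf:
  assumes "finite I0" "finite Iinf" "i \<in> Iinf"
  shows "has_series_symbol (H_inf p i) (Hamiltonian_inf_symbol p i)"
proof (cases p)
  case (Pair tinf t0)
  let ?F = "\<lambda>j l k. scalar (1 / (tinf i - tinf k)) * four_cycle j i l k"
  have "has_symbol 4 (Tr\<^bsub>weyl\<^esub> (Qh j k \<bullet>\<^bsub>weyl\<^esub> Ph k j \<bullet>\<^bsub>weyl\<^esub> Qh j i \<bullet>\<^bsub>weyl\<^esub> Ph i j)) (four_cycle j i j k)"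
    if "j \<in> I0" "k \<in> Iinf" for j k
    using has_symbol_four_cycle_Q[of j j k i] that assms by (simp add: four_cycle_rotate[of j i])
  then have "has_series_symbol (H_inf p i) (\<lambda>n.
    (if n = 4 then \<Sum>k\<in>Iinf - {i}. \<Sum>j\<in>I0. \<Sum>l\<in>I0 - {j}. ?F j l k else 0) +
    (if n = 4 then \<Sum>k\<in>Iinf - {i}. \<Sum>j\<in>I0. ?F j j k else 0) +
    (if n = 2 then \<Sum>j\<in>I0. scalar (t0 j) * two_cycle j i else 0))"
    unfolding H_inf_def Pair prod.case using assms
    by (intro has_series_symbol_add has_series_symbol_monom has_symbol_symmetrized
        has_symbol_finsum has_symbol_scale has_symbol_four_cycle_P
        has_symbol_two_cycle_P has_symbol_two_cycle_Q) auto
  moreover have "(\<Sum>k\<in>Iinf - {i}. \<Sum>j\<in>I0. \<Sum>l\<in>I0. ?F j l k)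
    = (\<Sum>k\<in>Iinf - {i}. \<Sum>j\<in>I0. \<Sum>l\<in>I0 - {j}. ?F j l k) + (\<Sum>k\<in>Iinf - {i}. \<Sum>j\<in>I0. ?F j j k)"
    using assms(1) by (simp add: sum.remove[of I0] add.commute flip: sum.distrib)
  ultimately show ?thesis
    unfolding Hamiltonian_inf_symbol_def Pair prod.case
    by (elim back_subst[where P = "has_series_symbol _"]) auto
qed

text \<open>
  As at infinity, with the two parts of the graph exchanged. The degenerate traces now start
  with \<open>P\<close>.
\<close>

lemma has_series_symbol_H_zero:
  assumes "finite I0" "finite Iinf" "j \<in> I0"
  shows "has_series_symbol (H_zero p j) (Hamiltonian_zero_symbol p j)"
proof (cases p)
  case (Pair tinf t0)
  let ?F = "\<lambda>i k l. scalar (1 / (t0 j - t0 l)) * four_cycle j i l k"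
  have "has_series_symbol (H_zero p j) (\<lambda>n.
    (if n = 4 then \<Sum>l\<in>I0 - {j}. \<Sum>i\<in>Iinf. \<Sum>k\<in>Iinf - {i}. ?F i k l else 0) +
    (if n = 4 then \<Sum>l\<in>I0 - {j}. \<Sum>i\<in>Iinf. ?F i i l else 0) +
    (if n = 2 then \<Sum>i\<in>Iinf. scalar (tinf i) * two_cycle j i else 0))"
    unfolding H_zero_def Pair prod.case using assms
    by (intro has_series_symbol_add has_series_symbol_monom has_symbol_symmetrized
        has_symbol_finsum has_symbol_scale has_symbol_four_cycle_Q has_symbol_four_cycle_P
        has_symbol_two_cycle_P has_symbol_two_cycle_Q) auto
  moreover have "(\<Sum>l\<in>I0 - {j}. \<Sum>i\<in>Iinf. \<Sum>k\<in>Iinf. ?F i k l)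
    = (\<Sum>l\<in>I0 - {j}. \<Sum>i\<in>Iinf. \<Sum>k\<in>Iinf - {i}. ?F i k l) + (\<Sum>l\<in>I0 - {j}. \<Sum>i\<in>Iinf. ?F i i l)"
    using assms(2) by (simp add: sum.remove[of Iinf] add.commute flip: sum.distrib)
  ultimately show ?thesis
    unfolding Hamiltonian_zero_symbol_def Pair prod.case
    by (elim back_subst[where P = "has_series_symbol _"]) auto
qed

lemma connection_difference_in_semiclassical_kernel:
  assumes "finite I0" "finite Iinf" "v \<in> I0 \<union> Iinf"
  shows "connection_difference simply_laced_connection FMTV_connection p v \<in> semiclassical_kernel"
proof -
  define S where "S = (if v \<in> Iinf then Hamiltonian_inf_symbol p v else Hamiltonian_zero_symbol p v)"
  have "has_series_symbol (simply_laced_connection p v) (\<lambda>n. - S n)"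
    unfolding simply_laced_connection_def S_def using assms
    by (intro has_series_symbol_uminus) (auto intro: has_series_symbol_H_inf has_series_symbol_H_zero)
  moreover have "has_series_symbol (FMTV_connection p v) (\<lambda>n. - S n)"
    unfolding FMTV_connection_def S_def using assms
    by (intro has_series_symbol_uminus) (auto intro: has_series_symbol_FMTV_inf has_series_symbol_FMTV_zero)
  ultimately have "has_series_symbol
      (connection_difference simply_laced_connection FMTV_connection p v) (\<lambda>n. - S n - - S n)"
    unfolding connection_difference_def by (rule has_series_symbol_minus)
  then show ?thesis by (intro semiclassical_kernel_if_symbol_zero) simp
qed

end

theorem theorem9p3:
  fixes I0 Iinf :: "'v set" and d :: "'v \<Rightarrow> nat"
  assumes "finite I0" and "finite Iinf"
    and "I0 \<noteq> {}" and "Iinf \<noteq> {}" and "I0 \<inter> Iinf = {}"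
    and "\<forall>j\<in>I0. d j = 1"
  shows "\<forall>p \<in> simply_laced.base I0 Iinf. \<forall>v \<in> I0 \<union> Iinf.
    simply_laced.connection_difference I0 Iinf d
      (simply_laced.simply_laced_connection I0 Iinf d) (simply_laced.FMTV_connection I0 Iinf d) p v
    \<in> simply_laced.semiclassical_kernel I0 Iinf d"
  using simply_laced.connection_difference_in_semiclassical_kernel[OF assms(1,2)] by blast

end
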